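(* For every integer $n\geq 0$, $$\sum_{k=0}^{n}\binom{n}{k}(1+y)^{k}(1-t)^{n-k}A_{k}(t)=(1+yt)^{n}P_{n}^{(\mathrm{lpk},\mathrm{des})}\left(\frac{(1+y)^{2}t}{(y+t)(1+yt)},\frac{y+t}{1+yt}\right).$$ Equivalently, $$P_{n}^{(\mathrm{lpk},\mathrm{des})}(y,t)=\frac{1}{(1+uv)^{n}}\sum_{k=0}^{n}\binom{n}{k}(1+u)^{k}(1-v)^{n-k}A_{k}(v),$$ where $$u=\frac{1+t^{2}-2yt-(1-t)\sqrt{(1+t)^{2}-4yt}}{2(1-y)t},\qquad v=\frac{(1+t)^{2}-2yt-(1+t)\sqrt{(1+t)^{2}-4yt}}{2yt}.$$
   Context: $\mathfrak{S}_n$ is the set of permutations $\pi=\pi_1\cdots\pi_n$ of $[n]=\{1,\dots,n\}$. For $\pi\in\mathfrak{S}_n$: $\mathrm{des}(\pi)$ is the number of descents, i.e. of $i\in[n-1]$ with $\pi_i>\pi_{i+1}$; $\mathrm{lpk}(\pi)$ is the number of left peaks, where $i\in[n-1]$ is a left peak if either $2\le i\le n-1$ and $\pi_{i-1}<\pi_i>\pi_{i+1}$, or $i=1$ and $\pi_1>\pi_2$. The Eulerian polynomials are $A_n(t)=\sum_{\pi\in\mathfrak{S}_n}t^{\mathrm{des}(\pi)+1}$ for $n\ge1$ and $A_0(t)=1$. For $n\ge1$, $P_n^{(\mathrm{lpk},\mathrm{des})}(y,t)=\sum_{\pi\in\mathfrak{S}_n}y^{\mathrm{lpk}(\pi)}t^{\mathrm{des}(\pi)}$,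 and $P_0^{(\mathrm{lpk},\mathrm{des})}=1$. Here $y,t$ are indeterminates; the first identity is an identity of rational functions in $y,t$. In the second identity, $\sqrt{(1+t)^2-4yt}$ is the formal power series in $t$ over $\mathbb{Q}[y]$ with constant term $1$, so that $u$ and $v$ are formal power series in $t$ with coefficients in $\mathbb{Q}[y]$. *)

theory Defs
  imports
    "HOL-Combinatorics.Permutations"
    "HOL-Computational_Algebra.Computational_Algebra"
begin

definition des :: "nat \<Rightarrow> (nat \<Rightarrow> nat) \<Rightarrow> nat" where
  "des n p = card {i \<in> {1..<n}. p i > p (i + 1)}"

definition lpk :: "nat \<Rightarrow> (nat \<Rightarrow> nat) \<Rightarrow> nat" where
  "lpk n p = card {i \<in> {1..<n}.
     (2 \<le> i \<and> p (i - 1) < p i \<and> p i > p (i + 1)) \<or> (i = 1 \<and> p 1 > p 2)}"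

text \<open>
  The polynomials are given by their values at arbitrary elements of a commutative ring.
  At the indeterminates of a polynomial ring this is the polynomial itself; at other elements
  it is the result of substituting them.
\<close>

definition eulerian_poly :: "nat \<Rightarrow> 'a::comm_ring_1 \<Rightarrow> 'a" where
  "eulerian_poly n t =
     (if n = 0 then 1 else (\<Sum>p | p permutes {1..n}. t ^ (des n p + 1)))"

definition lpk_des_poly :: "nat \<Rightarrow> 'a::comm_ring_1 \<Rightarrow> 'a \<Rightarrow> 'a" where
  "lpk_des_poly n y t =
     (if n = 0 then 1 else (\<Sum>p | p permutes {1..n}. y ^ lpk n p * t ^ des n p))"

text \<open>The field of rational functions \<open>\<rat>(y,t)\<close>, as the fraction field of \<open>\<rat>[y][t]\<close>.\<close>

type_synonym ratfun = "rat poly poly fract"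

definition rf_y :: ratfun where "rf_y = to_fract [:[:0, 1:]:]"
definition rf_t :: ratfun where "rf_t = to_fract [:0, 1:]"

text \<open>The ring \<open>\<rat>[y][[t]]\<close>.\<close>

type_synonym series = "rat poly fps"

definition ps_y :: series where "ps_y = fps_const [:0, 1:]"
definition ps_t :: series where "ps_t = fps_X"

definition ps_sqrt :: series where
  "ps_sqrt = (THE s. s ^ 2 = (1 + ps_t) ^ 2 - 4 * ps_y * ps_t \<and> fps_nth s 0 = 1)"

text \<open>
  The quotients defining \<open>u\<close> and \<open>v\<close> have denominators that are not units of \<open>\<rat>[y][[t]]\<close>, so
  they are formed in its fraction field, into which \<open>\<rat>[y][[t]]\<close> embeds by \<^const>\<open>to_fract\<close>.
  The lemmas \<open>ser_u_power_series\<close> and \<open>ser_v_power_series\<close> show that they lie in \<open>\<rat>[y][[t]]\<close>.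
\<close>

definition ser_u :: "series fract" where
  "ser_u = (let y = to_fract ps_y; t = to_fract ps_t; s = to_fract ps_sqrt in
     (1 + t ^ 2 - 2 * y * t - (1 - t) * s) / (2 * (1 - y) * t))"

definition ser_v :: "series fract" where
  "ser_v = (let y = to_fract ps_y; t = to_fract ps_t; s = to_fract ps_sqrt in
     ((1 + t) ^ 2 - 2 * y * t - (1 + t) * s) / (2 * y * t))"

lemma ps_sqrt_ex1:
  "\<exists>!s::series. s ^ 2 = (1 + ps_t) ^ 2 - 4 * ps_y * ps_t \<and> fps_nth s 0 = 1"
proof (rule ex_ex1I)
  define r :: series where "r = (1 + ps_t) ^ 2 - 4 * ps_y * ps_t - 1"
  have r0: "fps_nth r 0 = 0"
    by (simp add: r_def ps_t_def power2_eq_square)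
  define b :: "rat fps" where "b = fps_binomial (1/2)"
  define B :: series where "B = Abs_fps (\<lambda>n. [:fps_nth b n:])"
  have bb: "b * b = 1 + fps_X"
    unfolding b_def fps_binomial_add_mult[symmetric] by (simp add: fps_binomial_1)
  have BB: "B * B = 1 + fps_X"
  proof (rule fps_ext)
    fix n
    have "fps_nth (B * B) n = (\<Sum>i=0..n. [:fps_nth b i * fps_nth b (n - i):])"
      by (simp add: fps_mult_nth B_def mult.commute)
    also have "\<dots> = [:fps_nth (b * b) n:]"
      by (simp add: fps_mult_nth sum_to_poly)
    also have "\<dots> = fps_nth (1 + fps_X) n"
      unfolding bb by (auto simp: fps_X_def one_pCons)
    finally show "fps_nth (B * B) n = fps_nth (1 + fps_X) n" .
  qed
  have "(B oo r) ^ 2 = (B * B) oo r"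
    by (simp add: power2_eq_square fps_compose_mult_distrib[OF r0])
  also have "\<dots> = 1 + r"
    unfolding BB by (simp add: fps_compose_add_distrib r0)
  finally have "(B oo r) ^ 2 = (1 + ps_t) ^ 2 - 4 * ps_y * ps_t"
    by (simp add: r_def)
  moreover have "fps_nth (B oo r) 0 = 1"
    by (simp add: B_def b_def one_pCons)
  ultimately show "\<exists>s::series. s ^ 2 = (1 + ps_t) ^ 2 - 4 * ps_y * ps_t \<and> fps_nth s 0 = 1"
    by blast
next
  fix s s' :: series
  assume s: "s ^ 2 = (1 + ps_t) ^ 2 - 4 * ps_y * ps_t \<and> fps_nth s 0 = 1"
    and s': "s' ^ 2 = (1 + ps_t) ^ 2 - 4 * ps_y * ps_t \<and> fps_nth s' 0 = 1"
  have "s = s' \<or> s = - s'"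
    using s s' by (simp flip: power2_eq_iff)
  moreover have "s \<noteq> - s'"
  proof
    assume "s = - s'"
    then have "fps_nth s 0 = - fps_nth s' 0" by simp
    with s s' show False by simp
  qed
  ultimately show "s = s'" by blast
qed

lemma ps_sqrt_square: "ps_sqrt ^ 2 = (1 + ps_t) ^ 2 - 4 * ps_y * ps_t"
  and ps_sqrt_nth_0: "fps_nth ps_sqrt 0 = 1"
  using theI'[OF ps_sqrt_ex1] unfolding ps_sqrt_def by blast+

lemma series_unit:
  fixes f :: series
  assumes "fps_nth f 0 = 2"
  obtains g where "f * g = 1"
proof -
  have "[:2:] * [:1/2:] = (1 :: rat poly)" by (simp add: one_pCons)
  then have "fps_nth f 0 * [:1/2:] = 1"
    using assms by (simp add: numeral_poly)
  then have "f * fps_right_inverse f [:1/2:] = 1"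
    by (rule fps_right_inverse)
  then show ?thesis by (rule that)
qed

lemma ser_u_power_series: "\<exists>u. ser_u = to_fract (ps_t * u)"
proof -
  define D where "D = 1 + ps_t ^ 2 - 2 * ps_y * ps_t + (1 - ps_t) * ps_sqrt"
  have "fps_nth D 0 = 2"
    by (simp add: D_def ps_t_def ps_sqrt_nth_0 power2_eq_square)
  then obtain g where g: "D * g = 1" by (rule series_unit)
  define N where "N = 1 + ps_t ^ 2 - 2 * ps_y * ps_t - (1 - ps_t) * ps_sqrt"
  have "N * D = (1 + ps_t ^ 2 - 2 * ps_y * ps_t) ^ 2 - (1 - ps_t) ^ 2 * ps_sqrt ^ 2"
    by (simp add: N_def D_def algebra_simps power2_eq_square)
  also have "\<dots> = 4 * ps_t ^ 2 * (1 - ps_y) ^ 2"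
    unfolding ps_sqrt_square by (simp add: algebra_simps power2_eq_square)
  finally have ND: "N * D = 4 * ps_t ^ 2 * (1 - ps_y) ^ 2" .
  have "N = N * D * g" using g by (simp add: mult.assoc)
  also have "\<dots> = (2 * (1 - ps_y) * ps_t) * (ps_t * (2 * (1 - ps_y) * g))"
    unfolding ND by (simp add: algebra_simps power2_eq_square)
  finally have N: "N = (2 * (1 - ps_y) * ps_t) * (ps_t * (2 * (1 - ps_y) * g))" .
  have "ps_y \<noteq> 1"
  proof
    assume "ps_y = 1"
    then have "fps_nth ps_y 0 = 1" by simp
    then show False by (simp add: ps_y_def one_pCons)
  qed
  then have nz: "2 * (1 - ps_y) * ps_t \<noteq> 0" by (simp add: ps_t_def)
  have two: "(2 :: series fract) = to_fract 2"
    unfolding one_add_one[symmetric] by (simp only: to_fract_add to_fract_1)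
  have "ser_u = to_fract N / to_fract (2 * (1 - ps_y) * ps_t)"
    unfolding ser_u_def N_def two Let_def power2_eq_square
    by (simp only: to_fract_mult to_fract_add to_fract_diff to_fract_1)
  also have "\<dots> = to_fract (ps_t * (2 * (1 - ps_y) * g))"
    unfolding N to_fract_mult[of "2 * (1 - ps_y) * ps_t"]
    using nz by (simp only: nonzero_mult_div_cancel_left to_fract_eq_0_iff not_False_eq_True)
  finally show ?thesis by blast
qed

lemma ser_v_power_series: "\<exists>v. ser_v = to_fract (ps_t * v)"
proof -
  define D where "D = (1 + ps_t) ^ 2 - 2 * ps_y * ps_t + (1 + ps_t) * ps_sqrt"
  have "fps_nth D 0 = 2"
    by (simp add: D_def ps_t_def ps_sqrt_nth_0 power2_eq_square)
  then obtain g where g: "D * g = 1" by (rule series_unit)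
  define N where "N = (1 + ps_t) ^ 2 - 2 * ps_y * ps_t - (1 + ps_t) * ps_sqrt"
  have "N * D = ((1 + ps_t) ^ 2 - 2 * ps_y * ps_t) ^ 2 - (1 + ps_t) ^ 2 * ps_sqrt ^ 2"
    by (simp add: N_def D_def algebra_simps power2_eq_square)
  also have "\<dots> = 4 * ps_y ^ 2 * ps_t ^ 2"
    unfolding ps_sqrt_square by (simp add: algebra_simps power2_eq_square)
  finally have ND: "N * D = 4 * ps_y ^ 2 * ps_t ^ 2" .
  have "N = N * D * g" using g by (simp add: mult.assoc)
  also have "\<dots> = (2 * ps_y * ps_t) * (ps_t * (2 * ps_y * g))"
    unfolding ND by (simp add: algebra_simps power2_eq_square)
  finally have N: "N = (2 * ps_y * ps_t) * (ps_t * (2 * ps_y * g))" .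
  have nz: "2 * ps_y * ps_t \<noteq> 0" by (simp add: ps_t_def ps_y_def)
  have two: "(2 :: series fract) = to_fract 2"
    unfolding one_add_one[symmetric] by (simp only: to_fract_add to_fract_1)
  have "ser_v = to_fract N / to_fract (2 * ps_y * ps_t)"
    unfolding ser_v_def N_def two Let_def power2_eq_square
    by (simp only: to_fract_mult to_fract_add to_fract_diff to_fract_1)
  also have "\<dots> = to_fract (ps_t * (2 * ps_y * g))"
    unfolding N to_fract_mult[of "2 * ps_y * ps_t"]
    using nz by (simp only: nonzero_mult_div_cancel_left to_fract_eq_0_iff not_False_eq_True)
  finally show ?thesis by blast
qed

end

theory Submission
  imports Defs "HOL-Combinatorics.Multiset_Permutations"
begin

text \<open>
  Label each gap of the word \<open>0 \<pi>\<^sub>1 \<dots> \<pi>\<^sub>n\<close>: an ascent followed by a descent (a left peak) contributes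
  \<open>a\<close>, every other descent \<open>b\<close>, every other ascent \<open>c\<close>, so that \<open>\<pi>\<close> has weight
  \<open>a\<^bsup>lpk\<^esup> b\<^bsup>des - lpk\<^esup> c\<^bsup>n - des - lpk\<^esup>\<close>.  Inserting \<open>n + 1\<close> in all possible ways acts on the weights as
  \<open>D + c\<close>, where \<open>D\<close> is a derivation with \<open>D b = D c = a\<close> and \<open>D a = a (b + c)\<close>; the total weight
  of \<open>\<SS>\<^sub>n\<close> is therefore \<open>(D + c)\<^sup>n 1\<close>.

  Fix \<open>y\<close> and \<open>s = 1 - t\<close>, let \<open>z = x - (1 + y) s\<close>, and let \<open>D = x z d/dx\<close> on polynomials in \<open>x\<close>.
  Then \<open>b = x - s\<close>, \<open>c = x - y s\<close>, \<open>a = x z\<close> satisfy these rules and take the values \<open>y + t\<close>,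
  \<open>1 + y t\<close>, \<open>(1 + y)\<^sup>2 t\<close> at \<open>x = 1 + y\<close>.  Since \<open>D x = x z\<close> and \<open>c = z + s\<close>,
  \<open>x (D + c)\<^sup>n 1 = (D + s)\<^sup>n x = (\<Sum>k. (n choose k) s\<^bsup>n - k\<^esup> D\<^sup>k x)\<close>.  The choice \<open>(a, b, c) = (x z, z, x)\<close>
  satisfies the rules as well and identifies \<open>D\<^sup>k x\<close> as a homogeneous Eulerian polynomial.  The second
  identity is the first one with \<open>u, v\<close> in place of \<open>y, t\<close>.
\<close>

section \<open>Insertion of a maximal letter\<close>

text \<open>A list rather than a set, so that sums over all insertions follow the recursion on the
  word.\<close>

fun insertions :: "'b \<Rightarrow> 'b list \<Rightarrow> 'b list list" where
  "insertions m [] = [[m]]"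
| "insertions m (v # xs) = (m # v # xs) # map ((#) v) (insertions m xs)"

lemma set_insertions: "set (insertions m xs) = {us @ m # vs | us vs. xs = us @ vs}"
proof (induction xs)
  case (Cons v xs)
  show ?case
  proof (intro equalityI subsetI)
    fix ys assume "ys \<in> set (insertions m (v # xs))"
    then consider "ys = m # v # xs" | us vs where "xs = us @ vs" "ys = (v # us) @ m # vs"
      using Cons by auto
    then show "ys \<in> {us @ m # vs | us vs. v # xs = us @ vs}"
    proof cases
      case 1
      then have "ys = [] @ m # v # xs \<and> v # xs = [] @ v # xs" by simp
      then show ?thesis by blast
    next
      case 2
      then have "ys = (v # us) @ m # vs \<and> v # xs = (v # us) @ vs" by simp
      then show ?thesis by blast
    qed
  next
    fix ys assume "ys \<in> {us @ m # vs | us vs. v # xs = us @ vs}"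
    then obtain us vs where "ys = us @ m # vs" "v # xs = us @ vs" by blast
    then show "ys \<in> set (insertions m (v # xs))"
      using Cons by (cases us) auto
  qed
qed simp

lemma distinct_insertions: "m \<notin> set xs \<Longrightarrow> distinct (insertions m xs)"
  by (induction xs) (auto simp: distinct_map)

text \<open>Insertions into different words therefore never coincide, which makes the union over
  words a disjoint one.\<close>

lemma remove1_insertions: "m \<notin> set xs \<Longrightarrow> ys \<in> set (insertions m xs) \<Longrightarrow> remove1 m ys = xs"
  by (auto simp: set_insertions remove1_append)

lemma permutations_of_set_insert:
  assumes "m \<notin> A"
  shows "permutations_of_set (insert m A) = (\<Union>xs\<in>permutations_of_set A. set (insertions m xs))"
proof (intro equalityI subsetI)
  fix ys assume ys: "ys \<in> permutations_of_set (insert m A)"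
  then have "m \<in> set ys" by (simp add: permutations_of_set_def)
  then obtain us vs where eq: "ys = us @ m # vs" by (meson split_list)
  with ys assms have "us @ vs \<in> permutations_of_set A"
    by (auto simp: permutations_of_set_def)
  with eq show "ys \<in> (\<Union>xs\<in>permutations_of_set A. set (insertions m xs))"
    by (auto simp: set_insertions)
qed (use assms in \<open>auto simp: permutations_of_set_def set_insertions\<close>)

lemma sum_permutations_of_set_insert:
  fixes f :: "'b list \<Rightarrow> 'c::comm_monoid_add"
  assumes "finite A" and m: "m \<notin> A"
  shows "(\<Sum>ys\<in>permutations_of_set (insert m A). f ys) =
    (\<Sum>xs\<in>permutations_of_set A. \<Sum>ys\<leftarrow>insertions m xs. f ys)"
proof -
  have notin: "m \<notin> set xs" if "xs \<in> permutations_of_set A" for xs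
    using that m by (auto simp: permutations_of_set_def)
  have "(\<Sum>ys\<in>permutations_of_set (insert m A). f ys) =
      (\<Sum>xs\<in>permutations_of_set A. sum f (set (insertions m xs)))"
    unfolding permutations_of_set_insert[OF m]
  proof (rule sum.UNION_disjoint)
    show "\<forall>xs\<in>permutations_of_set A. \<forall>xs'\<in>permutations_of_set A.
        xs \<noteq> xs' \<longrightarrow> set (insertions m xs) \<inter> set (insertions m xs') = {}"
      using notin remove1_insertions by (metis disjoint_iff)
  qed simp_all
  also have "\<dots> = (\<Sum>xs\<in>permutations_of_set A. \<Sum>ys\<leftarrow>insertions m xs. f ys)"
    by (intro sum.cong refl) (simp add: sum_list_distinct_conv_sum_set distinct_insertions notin)
  finally show ?thesis .
qed

section \<open>Gap weights\<close>

context
  fixes a b c :: "'a::comm_ring_1"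
begin

text \<open>\<open>u\<close> is the letter before the word. A peak \<open>u < v > w\<close> accounts
  for two gaps at once, so the recursion resumes at \<open>w\<close>.\<close>

fun gap_weight :: "nat \<Rightarrow> nat list \<Rightarrow> 'a" where
  "gap_weight u [] = 1"
| "gap_weight u [v] = (if u < v then c else b)"
| "gap_weight u (v # w # xs) =
    (if u < v \<and> w < v then a * gap_weight w xs
     else (if u < v then c else b) * gap_weight v (w # xs))"

lemma gap_weight_Cons:
  assumes "\<not> (u < v \<and> xs \<noteq> [] \<and> hd xs < v)"
  shows "gap_weight u (v # xs) = (if u < v then c else b) * gap_weight v xs"
  using assms by (cases xs) auto

lemma gap_weight_descent: "w < v \<Longrightarrow> gap_weight v (w # xs) = b * gap_weight w xs"
  by (simp add: gap_weight_Cons)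

definition total_weight :: "nat \<Rightarrow> 'a" where
  "total_weight n = (\<Sum>xs\<in>permutations_of_set {1..n}. gap_weight 0 xs)"

lemma total_weight_0: "total_weight 0 = 1"
  by (simp add: total_weight_def)

text \<open>\<open>L m\<close> counts the peaks after position \<open>m\<close>, \<open>E m\<close>
  the descents from \<open>m\<close> on. The inequalities are carried along because the exponents
  are truncated differences; the induction is strong because a peak advances by two
  positions.\<close>

lemma gap_weight_map:
  fixes p :: "nat \<Rightarrow> nat" and m n :: nat
  defines "L \<equiv> \<lambda>m. card {i \<in> {Suc m..<n}. p (i - 1) < p i \<and> p (Suc i) < p i}"
    and "E \<equiv> \<lambda>m. card {i \<in> {m..<n}. p (Suc i) < p i}"
  assumes "m \<le> n" and "inj p"
  shows "L m \<le> E m \<and> E m + L m \<le> n - m \<and>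
    gap_weight (p m) (map p [Suc m..<Suc n]) = a ^ L m * b ^ (E m - L m) * c ^ (n - m - E m - L m)"
  using \<open>m \<le> n\<close>
proof (induction "n - m" arbitrary: m rule: less_induct)
  case (less m)
  show ?case
  proof (cases "m = n")
    case True
    then have "L m = 0" "E m = 0" by (auto simp: L_def E_def card_eq_0_iff)
    with True show ?thesis by simp
  next
    case False
    with less.prems have mn: "m < n" by simp
    have E: "E m = (if p (Suc m) < p m then 1 else 0) + E (Suc m)" if "m < n" for m
    proof -
      have "{i \<in> {m..<n}. p (Suc i) < p i} =
          (if p (Suc m) < p m then {m} else {}) \<union> {i \<in> {Suc m..<n}. p (Suc i) < p i}"
        using that by (auto simp: Suc_le_eq order_le_less)
      then show ?thesis by (simp add: E_def card_insert_if)
    qed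
    have L: "L m = (if Suc m < n \<and> p m < p (Suc m) \<and> p (Suc (Suc m)) < p (Suc m) then 1 else 0)
        + L (Suc m)" for m
    proof -
      have "{i \<in> {Suc m..<n}. p (i - 1) < p i \<and> p (Suc i) < p i} =
          (if Suc m < n \<and> p m < p (Suc m) \<and> p (Suc (Suc m)) < p (Suc m) then {Suc m} else {}) \<union>
          {i \<in> {Suc (Suc m)..<n}. p (i - 1) < p i \<and> p (Suc i) < p i}"
        by (auto simp: Suc_le_eq order_le_less)
      then show ?thesis by (simp add: L_def card_insert_if)
    qed
    have up: "[Suc m..<Suc n] = Suc m # [Suc (Suc m)..<Suc n]"
      using mn by (simp add: upt_conv_Cons)
    have neq: "p m \<noteq> p (Suc m)" using \<open>inj p\<close> by (simp add: inj_eq)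
    show ?thesis
    proof (cases "Suc m < n \<and> p m < p (Suc m) \<and> p (Suc (Suc m)) < p (Suc m)")
      case True
      have up2: "[Suc m..<Suc n] = Suc m # Suc (Suc m) # [Suc (Suc (Suc m))..<Suc n]"
        using True by (simp add: upt_conv_Cons)
      \<comment> \<open>Position \<open>m\<close> is no descent and \<open>Suc m\<close> is one; the
        next letter lies below its predecessor and so is no peak.\<close>
      have "L m = Suc (L (Suc (Suc m)))" "E m = Suc (E (Suc (Suc m)))"
        using True mn L[of m] L[of "Suc m"] E[of m] E[of "Suc m"] by auto
      moreover have "gap_weight (p m) (map p [Suc m..<Suc n]) =
          a * gap_weight (p (Suc (Suc m))) (map p [Suc (Suc (Suc m))..<Suc n])"
        unfolding up2 using True by simp
      moreover note less.hyps[of "Suc (Suc m)"]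
      moreover have "n - Suc (Suc m) < n - m" "Suc (Suc m) \<le> n" "n - m = Suc (Suc (n - Suc (Suc m)))"
        using True by auto
      ultimately show ?thesis by (simp add: mult.assoc)
    next
      case nonpeak: False
      define g where "g = (if p m < p (Suc m) then c else b)"
      have IH: "L (Suc m) \<le> E (Suc m)" "E (Suc m) + L (Suc m) \<le> n - Suc m"
        "gap_weight (p (Suc m)) (map p [Suc (Suc m)..<Suc n]) = a ^ L (Suc m) *
          b ^ (E (Suc m) - L (Suc m)) * c ^ (n - Suc m - E (Suc m) - L (Suc m))"
        using less.hyps[of "Suc m"] mn by auto
      have L': "L m = L (Suc m)" and E': "E m = (if p m < p (Suc m) then 0 else 1) + E (Suc m)"
        using nonpeak L[of m] E[OF mn] neq by auto
      have exps: "E m - L m = (if p m < p (Suc m) then 0 else 1) + (E (Suc m) - L (Suc m))"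
        "n - m - E m - L m =
          (if p m < p (Suc m) then 1 else 0) + (n - Suc m - E (Suc m) - L (Suc m))"
        using L' E' IH(1,2) mn by auto
      have "gap_weight (p m) (map p [Suc m..<Suc n]) =
          g * gap_weight (p (Suc m)) (map p [Suc (Suc m)..<Suc n])"
        unfolding up list.map g_def
        by (rule gap_weight_Cons) (use nonpeak in \<open>auto simp del: upt_Suc simp: hd_map\<close>)
      also have "\<dots> = a ^ L m * b ^ (E m - L m) * c ^ (n - m - E m - L m)"
        unfolding IH(3) exps unfolding L' by (simp add: g_def ac_simps)
      finally show ?thesis
        using L' E' IH(1,2) mn by (auto simp del: upt_Suc)
    qed
  qed
qed

lemma permutes_weight:
  assumes p: "p permutes {1..n}"
  shows "lpk n p \<le> des n p \<and> des n p + lpk n p \<le> n \<and>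
    gap_weight 0 (map p [1..<Suc n]) = a ^ lpk n p * b ^ (des n p - lpk n p) * c ^ (n - des n p - lpk n p)"
proof -
  \<comment> \<open>As \<open>p\<close> fixes 0, it supplies the leading letter itself: position 0
    is no descent, and position 1 is a peak exactly when \<open>p 1 > p 2\<close>.\<close>
  have p0: "p 0 = 0" using p by (auto simp: permutes_def)
  have p1: "0 < p i" if "i \<in> {1..n}" for i
    using that permutes_in_image[OF p, of i] by auto
  have "{i \<in> {0..<n}. p (Suc i) < p i} = {i \<in> {1..<n}. p i > p (i + 1)}"
    using p0 by (auto simp: Suc_le_eq) (metis gr0I not_less_zero)
  moreover have "{i \<in> {Suc 0..<n}. p (i - 1) < p i \<and> p (Suc i) < p i} =
      {i \<in> {1..<n}. (2 \<le> i \<and> p (i - 1) < p i \<and> p i > p (i + 1)) \<or> (i = 1 \<and> p 1 > p 2)}"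
  proof (rule Collect_cong)
    show "i \<in> {Suc 0..<n} \<and> p (i - 1) < p i \<and> p (Suc i) < p i \<longleftrightarrow> i \<in> {1..<n} \<and>
        ((2 \<le> i \<and> p (i - 1) < p i \<and> p i > p (i + 1)) \<or> (i = 1 \<and> p 1 > p 2))" for i
      using p0 p1[of 1] by (cases "i = 1") (auto simp: numeral_2_eq_2)
  qed
  ultimately show ?thesis
    using gap_weight_map[of 0 n p] permutes_inj[OF p] p0
    by (simp add: des_def lpk_def)
qed

text \<open>Surjectivity follows by counting: both sets have \<open>n!\<close> elements.\<close>

lemma bij_betw_permutes_lists:
  "bij_betw (\<lambda>p. map p [1..<Suc n]) {p. p permutes {1..n}} (permutations_of_set {1..n})"
proof -
  have inj: "inj_on (\<lambda>p. map p [1..<Suc n]) {p. p permutes {1..n}}"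
  proof (rule inj_onI)
    fix p q
    assume p: "p \<in> {p. p permutes {1..n}}" and q: "q \<in> {p. p permutes {1..n}}"
      and "map p [1..<Suc n] = map q [1..<Suc n]"
    then have "p i = q i" if "i \<in> {1..n}" for i using that by (auto simp del: upt_Suc)
    moreover have "p i = q i" if "i \<notin> {1..n}" for i
      using that p q by (simp add: permutes_def)
    ultimately show "p = q" by blast
  qed
  have "(\<lambda>p. map p [1..<Suc n]) ` {p. p permutes {1..n}} \<subseteq> permutations_of_set {1..n}"
  proof clarify
    fix p assume p: "p permutes {1..n}"
    have "{1..<Suc n} = {1..n}" by auto
    with p show "map p [1..<Suc n] \<in> permutations_of_set {1..n}"
      by (simp add: permutations_of_set_def distinct_map permutes_inj_on permutes_image del: upt_Suc)
  qed
  moreover have "card ((\<lambda>p. map p [1..<Suc n]) ` {p. p permutes {1..n}}) =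
      card (permutations_of_set {1..n})"
    unfolding card_image[OF inj] by (simp add: card_permutations[of _ n])
  ultimately show ?thesis
    using inj by (simp add: bij_betw_def card_subset_eq)
qed

lemma total_weight_eq:
  "total_weight n =
    (\<Sum>p | p permutes {1..n}. a ^ lpk n p * b ^ (des n p - lpk n p) * c ^ (n - des n p - lpk n p))"
  unfolding total_weight_def
  by (subst sum.reindex_bij_betw[OF bij_betw_permutes_lists, symmetric], rule sum.cong[OF refl])
    (use permutes_weight in blast)

end

section \<open>Derivations and the insertion recurrence\<close>

locale derivation =
  fixes D :: "'a::comm_ring_1 \<Rightarrow> 'a"
  assumes add: "D (p + q) = D p + D q"
    and mult: "D (p * q) = D p * q + p * D q"
begin

lemma zero: "D 0 = 0"
  using add[of 0 0] by simp

lemma one: "D 1 = 0"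
  using mult[of 1 1] by simp

lemma sum: "D (\<Sum>i\<in>I. f i) = (\<Sum>i\<in>I. D (f i))"
  by (induction I rule: infinite_finite_induct) (simp_all add: zero add)

lemma of_nat: "D (of_nat k) = 0"
  by (induction k) (simp_all add: zero one add)

lemma constant_mult: "D r = 0 \<Longrightarrow> D (r * p) = r * D p"
  by (simp add: mult)

lemma constant_power: "D r = 0 \<Longrightarrow> D (r ^ k) = 0"
  by (induction k) (simp_all add: one mult)

text \<open>A maximal letter put into a single ascent or descent makes it a peak
  (\<open>D c = D b = a\<close>). Put into either gap of a peak, it forms a new peak and leaves the
  other gap as a single \<open>b\<close> or \<open>c\<close> (\<open>D a = a * (b + c)\<close>). At
  the end of the word it adds an ascent \<open>c\<close>.\<close>

lemma sum_gap_weight_insertions: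
  assumes Da: "D a = a * (b + c)" and Db: "D b = a" and Dc: "D c = a"
    and "u < m" "\<forall>x\<in>set xs. x < m"
  shows "(\<Sum>ys\<leftarrow>insertions m xs. gap_weight a b c u ys) =
    D (gap_weight a b c u xs) + c * gap_weight a b c u xs"
  using assms(4-)
proof (induction xs arbitrary: u rule: length_induct)
  case (1 xs)
  let ?w = "gap_weight a b c"
  show ?case
  proof (cases xs)
    case Nil
    then show ?thesis using 1 by (simp add: one)
  next
    case (Cons v vs)
    have "u < m" "v < m" and less: "\<forall>x\<in>set vs. x < m" using 1 Cons by auto
    \<comment> \<open>Insertion directly before \<open>v\<close> creates the peak
      \<open>u < m > v\<close>.\<close>
    have split: "(\<Sum>ys\<leftarrow>insertions m xs. ?w u ys) =
        a * ?w v vs + (\<Sum>ys\<leftarrow>insertions m vs. ?w u (v # ys))"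
      using \<open>u < m\<close> \<open>v < m\<close> by (simp add: Cons o_def)
    show ?thesis
    proof (cases "u < v \<and> vs \<noteq> [] \<and> hd vs < v")
      case True
      then obtain w ws where vs: "vs = w # ws" and "u < v" "w < v" by (cases vs) auto
      have "w < m" using less vs by simp
      have IH: "(\<Sum>ys\<leftarrow>insertions m ws. ?w w ys) = D (?w w ws) + c * ?w w ws"
        using 1 Cons vs by auto
      \<comment> \<open>Directly after \<open>v\<close>, the letter \<open>m\<close> leaves the
        ascent from \<open>u\<close> to \<open>v\<close> and forms the peak
        \<open>v < m > w\<close>; later insertions keep the peak at \<open>v\<close>.\<close>
      have "(\<Sum>ys\<leftarrow>insertions m vs. ?w u (v # ys)) =
          c * (a * ?w w ws) + a * (\<Sum>ys\<leftarrow>insertions m ws. ?w w ys)"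
        using \<open>u < v\<close> \<open>w < v\<close> \<open>v < m\<close> \<open>w < m\<close>
        by (simp add: vs o_def sum_list_const_mult)
      then show ?thesis
        unfolding split IH using \<open>u < v\<close> \<open>w < v\<close>
        by (simp add: Cons vs gap_weight_descent mult Da algebra_simps)
    next
      case False
      define g where "g = (if u < v then c else b)"
      have Dg: "D g = a" by (simp add: g_def Db Dc)
      \<comment> \<open>The letter after \<open>v\<close> is now \<open>m > v\<close> or the same as
        before, so \<open>v\<close> does not become a peak.\<close>
      have "?w u (v # ys) = g * ?w v ys" if "ys \<in> set (insertions m vs)" for ys
        unfolding g_def
      proof (rule gap_weight_Cons)
        have "hd ys = m \<or> (vs \<noteq> [] \<and> hd ys = hd vs)"
          using that by (cases vs) auto
        then show "\<not> (u < v \<and> ys \<noteq> [] \<and> hd ys < v)"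
          using False \<open>v < m\<close> by auto
      qed
      then have "(\<Sum>ys\<leftarrow>insertions m vs. ?w u (v # ys)) = g * (\<Sum>ys\<leftarrow>insertions m vs. ?w v ys)"
        by (simp add: sum_list_const_mult cong: map_cong)
      moreover have "(\<Sum>ys\<leftarrow>insertions m vs. ?w v ys) = D (?w v vs) + c * ?w v vs"
        using 1 Cons \<open>v < m\<close> less by auto
      moreover have "?w u xs = g * ?w v vs"
        unfolding g_def Cons by (rule gap_weight_Cons) (use False in auto)
      ultimately show ?thesis
        unfolding split by (simp add: mult Dg algebra_simps)
    qed
  qed
qed

lemma total_weight_Suc:
  assumes "D a = a * (b + c)" "D b = a" "D c = a"
  shows "total_weight a b c (Suc n) = D (total_weight a b c n) + c * total_weight a b c n"
proof -
  have "total_weight a b c (Suc n) =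
      (\<Sum>xs\<in>permutations_of_set {1..n}. \<Sum>ys\<leftarrow>insertions (Suc n) xs. gap_weight a b c 0 ys)"
    unfolding total_weight_def
    by (simp add: atLeastAtMostSuc_conv sum_permutations_of_set_insert)
  also have "\<dots> = (\<Sum>xs\<in>permutations_of_set {1..n}.
      D (gap_weight a b c 0 xs) + c * gap_weight a b c 0 xs)"
    by (intro sum.cong refl sum_gap_weight_insertions assms)
      (auto simp: permutations_of_set_def)
  finally show ?thesis
    by (simp add: total_weight_def sum.distrib sum sum_distrib_left)
qed

text \<open>By the product rule \<open>D (z * w) = z * (D w + x * w)\<close>, which is the
  recurrence with \<open>c = x\<close>. At exponent 0 the two sides would be \<open>x\<close> and
  \<open>z\<close>.\<close>

lemma funpow_Suc_eq_total_weight: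
  assumes "D x = x * z" "D z = x * z"
  shows "(D ^^ Suc k) x = z * total_weight (x * z) z x (Suc k)"
proof (induction k)
  case 0
  have "total_weight (x * z) z x (Suc 0) = x"
    using assms by (subst total_weight_Suc) (simp_all add: mult total_weight_0 one algebra_simps)
  then show ?case by (simp add: assms mult.commute)
next
  case (Suc k)
  have "total_weight (x * z) z x (Suc (Suc k)) =
      D (total_weight (x * z) z x (Suc k)) + x * total_weight (x * z) z x (Suc k)"
    using assms by (intro total_weight_Suc) (simp_all add: mult algebra_simps)
  then show ?case
    using Suc by (simp add: mult assms algebra_simps)
qed

text \<open>Pascal's rule for the expansion of \<open>D + s\<close> iterated on \<open>x\<close>;
  \<open>D\<close> commutes with multiplication by \<open>s\<close> because
  \<open>D s = 0\<close>.\<close>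

lemma binomial_funpow_Suc:
  assumes s: "D s = 0"
  shows "(\<Sum>k\<le>Suc n. of_nat (Suc n choose k) * s ^ (Suc n - k) * (D ^^ k) x) =
    D (\<Sum>k\<le>n. of_nat (n choose k) * s ^ (n - k) * (D ^^ k) x) +
    s * (\<Sum>k\<le>n. of_nat (n choose k) * s ^ (n - k) * (D ^^ k) x)"
proof -
  let ?f = "\<lambda>n k. of_nat (n choose k) * s ^ (n - k) * (D ^^ k) x"
  have D: "D (?f n k) = of_nat (n choose k) * s ^ (n - k) * (D ^^ Suc k) x" for k
    using constant_mult[of "of_nat (n choose k) * s ^ (n - k)"]
    by (simp add: mult of_nat constant_power s)
  have shift: "(\<Sum>k\<le>Suc n. of_nat (n choose k) * s ^ (Suc n - k) * (D ^^ k) x) = s ^ Suc n * x +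
      (\<Sum>k\<le>n. of_nat (n choose Suc k) * s ^ (n - k) * (D ^^ Suc k) x)"
    by (subst sum.atMost_Suc_shift) simp
  have "(\<Sum>k\<le>Suc n. ?f (Suc n) k) = s ^ Suc n * x + (\<Sum>k\<le>n. ?f (Suc n) (Suc k))"
    by (subst sum.atMost_Suc_shift) simp
  also have "(\<Sum>k\<le>n. ?f (Suc n) (Suc k)) = D (\<Sum>k\<le>n. ?f n k) +
      (\<Sum>k\<le>n. of_nat (n choose Suc k) * s ^ (n - k) * (D ^^ Suc k) x)"
    unfolding sum D by (simp add: sum.distrib algebra_simps)
  also have "s ^ Suc n * x + (D (\<Sum>k\<le>n. ?f n k) +
      (\<Sum>k\<le>n. of_nat (n choose Suc k) * s ^ (n - k) * (D ^^ Suc k) x)) = D (\<Sum>k\<le>n. ?f n k) +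
      (\<Sum>k\<le>Suc n. of_nat (n choose k) * s ^ (Suc n - k) * (D ^^ k) x)"
    unfolding shift by (simp only: ac_simps)
  \<comment> \<open>The term \<open>k = Suc n\<close> has binomial coefficient 0; the others each
    contain one more factor \<open>s\<close>.\<close>
  also have "(\<Sum>k\<le>Suc n. of_nat (n choose k) * s ^ (Suc n - k) * (D ^^ k) x) = s * (\<Sum>k\<le>n. ?f n k)"
    by (auto simp: binomial_eq_0 sum_distrib_left Suc_diff_le ac_simps intro!: sum.cong)
  finally show ?thesis .
qed

lemma total_weight_binomial:
  assumes "D a = a * (b + c)" "D b = a" "D c = a"
    and x: "D x = x * z" and s: "D s = 0" and c: "c = z + s"
  shows "x * total_weight a b c n = (\<Sum>k\<le>n. of_nat (n choose k) * s ^ (n - k) * (D ^^ k) x)"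
proof (induction n)
  case 0
  then show ?case by (simp add: total_weight_0)
next
  case (Suc n)
  have "x * total_weight a b c (Suc n) = D (x * total_weight a b c n) + s * (x * total_weight a b c n)"
    using assms by (simp add: total_weight_Suc mult algebra_simps)
  then show ?case
    unfolding binomial_funpow_Suc[OF s] Suc by simp
qed

end

section \<open>Specialization\<close>

lemma derivation_pderiv: "derivation (\<lambda>p. g * pderiv p)"
  for g :: "'a::idom poly"
  by unfold_locales (simp_all add: pderiv_add pderiv_mult algebra_simps)

lemma poly_total_weight:
  "poly (total_weight a b c n) r = total_weight (poly a r) (poly b r) (poly c r) n"
  by (simp add: total_weight_eq poly_sum)

text \<open>Since \<open>a = b * c\<close> here, peaks leave no trace and the weight is
  \<open>r ^ n * t ^ des\<close> with \<open>n = Suc k\<close>; the prefactor supplies the shift to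
  \<open>des + 1\<close>.\<close>

lemma total_weight_eulerian:
  "r * t * total_weight (r * (r * t)) (r * t) r (Suc k) = r ^ (Suc k + 1) * eulerian_poly (Suc k) t"
  for r t :: "'a::comm_ring_1"
proof -
  have "r * t * ((r * (r * t)) ^ l * (r * t) ^ (d - l) * r ^ (Suc k - d - l)) =
      r ^ (Suc k + 1) * t ^ (d + 1)" if "l \<le> d" "d + l \<le> Suc k" for l d
  proof -
    \<comment> \<open>Writing \<open>d\<close> and \<open>Suc k\<close> as sums removes the
      truncated differences from the exponents.\<close>
    obtain e where d: "d = l + e" using \<open>l \<le> d\<close> le_Suc_ex by blast
    obtain f where f: "Suc k = d + l + f" using \<open>d + l \<le> Suc k\<close> le_Suc_ex by blast
    show ?thesis
      unfolding f unfolding d by (simp add: power_mult_distrib power_add ac_simps)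
  qed
  then show ?thesis
    unfolding total_weight_eq eulerian_poly_def sum_distrib_left
    using permutes_weight[of _ "Suc k" r r r] by (auto simp: sum_distrib_left intro!: sum.cong)
qed

text \<open>Relative to \<open>c ^ n\<close>, each descent trades a \<open>c\<close> for a
  \<open>b\<close>, and each peak trades a \<open>b\<close> and a \<open>c\<close> for an
  \<open>a\<close>.\<close>

lemma total_weight_lpk_des:
  fixes a b c :: "'a::field"
  assumes "b \<noteq> 0" "c \<noteq> 0"
  shows "total_weight a b c n = c ^ n * lpk_des_poly n (a / (b * c)) (b / c)"
proof (cases "n = 0")
  case True
  then show ?thesis by (simp add: total_weight_0 lpk_des_poly_def)
next
  case False
  have "a ^ l * b ^ (d - l) * c ^ (n - d - l) = c ^ n * ((a / (b * c)) ^ l * (b / c) ^ d)"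
    if "l \<le> d" "d + l \<le> n" for l d
  proof -
    obtain e where d: "d = l + e" using \<open>l \<le> d\<close> le_Suc_ex by blast
    obtain f where f: "n = d + l + f" using \<open>d + l \<le> n\<close> le_Suc_ex by blast
    show ?thesis
      unfolding f unfolding d using assms
      by (simp add: power_divide power_mult_distrib power_add field_simps)
  qed
  then show ?thesis
    using False permutes_weight[of _ n a b c]
    by (auto simp: total_weight_eq lpk_des_poly_def sum_distrib_left intro!: sum.cong)
qed

text \<open>Stated over any field, to serve both for the indeterminates and for \<open>u, v\<close>.
  The factor \<open>1 + y\<close>, the value of \<open>x\<close>, is cancelled at the end.\<close>

lemma eulerian_lpk_des_identity:
  fixes y t :: "'a::field"
  assumes "1 + y \<noteq> 0" "y + t \<noteq> 0" "1 + y * t \<noteq> 0"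
  shows "(\<Sum>k=0..n. of_nat (n choose k) * (1 + y) ^ k * (1 - t) ^ (n - k) * eulerian_poly k t) =
    (1 + y * t) ^ n *
      lpk_des_poly n ((1 + y) ^ 2 * t / ((y + t) * (1 + y * t))) ((y + t) / (1 + y * t))"
proof -
  define s where "s = [:1 - t:]"
  define x z b c :: "'a poly" where "x = [:0, 1:]" and "z = [:- ((1 + y) * (1 - t)), 1:]"
    and "b = [:- (1 - t), 1:]" and "c = [:- (y * (1 - t)), 1:]"
  define D where "D = (\<lambda>p. x * z * pderiv p)"
  interpret derivation D
    unfolding D_def by (rule derivation_pderiv)
  \<comment> \<open>\<open>x\<close>, \<open>z\<close>, \<open>b\<close>, \<open>c\<close> differ
    only by constants, so \<open>D\<close> sends all four to \<open>x * z\<close>.\<close>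
  have x: "D x = x * z" and z: "D z = x * z" and b: "D b = x * z" and c: "D c = x * z" and s: "D s = 0"
    by (simp_all add: D_def x_def z_def b_def c_def s_def pderiv_pCons)
  have "c = z + s" and zx: "z + x = b + c"
    by (simp_all add: x_def z_def b_def c_def s_def algebra_simps)
  have "D (x * z) = x * z * (z + x)"
    by (simp add: mult x z algebra_simps)
  then have a: "D (x * z) = x * z * (b + c)"
    unfolding zx .
  have val: "poly x (1 + y) = 1 + y" "poly z (1 + y) = (1 + y) * t" "poly b (1 + y) = y + t"
    "poly c (1 + y) = 1 + y * t" "poly s (1 + y) = 1 - t"
    by (simp_all add: x_def z_def b_def c_def s_def algebra_simps)
  have pow: "poly ((D ^^ k) x) (1 + y) = (1 + y) ^ (k + 1) * eulerian_poly k t" for k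
  proof (cases k)
    case 0
    then show ?thesis by (simp add: val eulerian_poly_def)
  next
    case (Suc j)
    show ?thesis
      unfolding Suc funpow_Suc_eq_total_weight[OF x z]
      by (simp add: poly_total_weight val total_weight_eulerian del: power_Suc)
  qed
  have "(1 + y) * total_weight ((1 + y) ^ 2 * t) (y + t) (1 + y * t) n =
      poly (x * total_weight (x * z) b c n) (1 + y)"
    by (simp add: poly_total_weight val power2_eq_square mult.assoc)
  also have "\<dots> = (1 + y) *
      (\<Sum>k=0..n. of_nat (n choose k) * (1 + y) ^ k * (1 - t) ^ (n - k) * eulerian_poly k t)"
    unfolding total_weight_binomial[OF a b c x s \<open>c = z + s\<close>]
    by (simp add: poly_sum val pow sum_distrib_left atLeast0AtMost ac_simps)
  finally show ?thesis
    using assms by (simp add: total_weight_lpk_des)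
qed

section \<open>Nonvanishing denominators and inversion of the substitution\<close>

lemma rf_nonzero: "1 + rf_y \<noteq> 0" "rf_y + rf_t \<noteq> 0" "1 + rf_y * rf_t \<noteq> 0"
  unfolding rf_y_def rf_t_def
  by (simp_all add: one_pCons flip: to_fract_1 to_fract_add to_fract_mult)

text \<open>\<open>ser_u\<close> and \<open>ser_v\<close> are multiples of \<open>ps_t\<close>, so
  both expressions are series with constant term 1.\<close>

lemma ser_nonzero: "1 + ser_u \<noteq> 0" "1 + ser_u * ser_v \<noteq> 0"
proof -
  obtain u v where uv: "ser_u = to_fract (ps_t * u)" "ser_v = to_fract (ps_t * v)"
    using ser_u_power_series ser_v_power_series by blast
  have *: "1 + to_fract (ps_t * f) \<noteq> 0" for f
  proof -
    have "fps_nth (1 + ps_t * f) 0 \<noteq> 0" by (simp add: ps_t_def)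
    then have "1 + ps_t * f \<noteq> 0" by (metis fps_zero_nth)
    then show ?thesis
      by (simp only: to_fract_eq_0_iff not_False_eq_True flip: to_fract_1 to_fract_add)
  qed
  show "1 + ser_u \<noteq> 0" "1 + ser_u * ser_v \<noteq> 0"
    using *[of u] *[of "u * (ps_t * v)"] by (simp_all add: uv ac_simps flip: to_fract_mult)
qed

text \<open>Up to division, these say that the substitution of the first identity sends
  \<open>(u, v)\<close> back to \<open>(y, t)\<close>.\<close>

lemma uv_identities:
  fixes y t s :: "'a::field"
  assumes s: "s ^ 2 = (1 + t) ^ 2 - 4 * y * t" and nz: "(2::'a) \<noteq> 0" "y \<noteq> 0" "1 - y \<noteq> 0" "t \<noteq> 0"
    and u: "u = (1 + t ^ 2 - 2 * y * t - (1 - t) * s) / (2 * (1 - y) * t)"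
    and v: "v = ((1 + t) ^ 2 - 2 * y * t - (1 + t) * s) / (2 * y * t)"
  shows "u + v = t * (1 + u * v)" "(1 + u) ^ 2 * v = y * t * (1 + u * v) ^ 2"
proof -
  \<comment> \<open>Rationalizing the numerators gives \<open>u = (s - 1 + t) / A\<close> and
    \<open>v = (1 + t - s) / B\<close>, whence \<open>1 + u = 2 * s / A\<close> and
    \<open>1 + u * v = 4 * s / (A * B)\<close>.\<close>
  define A B where "A = s + 1 - t" and "B = 1 + t + s"
  have yt: "4 * y * t = B * (1 + t - s)" and yt': "4 * (1 - y) * t = A * (s - 1 + t)"
    using s by (simp_all add: A_def B_def algebra_simps power2_eq_square)
  have "(2::'a) * 2 \<noteq> 0" using nz by (simp only: mult_eq_0_iff simp_thms not_False_eq_True)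
  then have four: "(4::'a) \<noteq> 0" by simp
  have AB: "A \<noteq> 0" "B \<noteq> 0"
    using yt yt' nz four by auto
  have U: "2 * (1 - y) * t * u = 1 + t ^ 2 - 2 * y * t - (1 - t) * s"
    and V: "2 * y * t * v = (1 + t) ^ 2 - 2 * y * t - (1 + t) * s"
    using nz by (simp_all add: u v)
  have "(2 * 2 * (1 - y) * t) * (u * A - (s - 1 + t)) = 0"
    using U s unfolding A_def by algebra
  then have uA: "u * A = s - 1 + t" using nz four by simp
  have "(2 * 2 * y * t) * (v * B - (1 + t - s)) = 0"
    using V s unfolding B_def by algebra
  then have vB: "v * B = 1 + t - s" using nz four by simp
  have one_u: "(1 + u) * A = 2 * s"
    using uA by (simp add: A_def algebra_simps)
  have one_uv: "(1 + u * v) * (A * B) = 4 * s"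
    using uA vB unfolding A_def B_def by algebra
  have "(u + v) * (A * B) = (t * (1 + u * v)) * (A * B)"
    using uA vB unfolding A_def B_def by algebra
  then show "u + v = t * (1 + u * v)" using AB by simp
  have "((1 + u) ^ 2 * v) * (A * B) ^ 2 = ((1 + u) * A) ^ 2 * (v * B) * B"
    by (simp add: power2_eq_square ac_simps)
  also have "\<dots> = 4 * s ^ 2 * (4 * y * t)"
    unfolding one_u vB yt by (simp add: power2_eq_square ac_simps)
  also have "\<dots> = (y * t) * ((1 + u * v) * (A * B)) ^ 2"
    unfolding one_uv by (simp add: power2_eq_square ac_simps)
  also have "\<dots> = (y * t * (1 + u * v) ^ 2) * (A * B) ^ 2"
    by (simp add: power_mult_distrib ac_simps)
  finally show "(1 + u) ^ 2 * v = y * t * (1 + u * v) ^ 2" using AB by simp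
qed

theorem theorem4p7:
  fixes n :: nat
  shows
    "(let y = rf_y; t = rf_t in
       (\<Sum>k=0..n. of_nat (n choose k) * (1 + y) ^ k * (1 - t) ^ (n - k) * eulerian_poly k t)
       = (1 + y * t) ^ n *
           lpk_des_poly n ((1 + y) ^ 2 * t / ((y + t) * (1 + y * t))) ((y + t) / (1 + y * t)))
     \<and>
     (let y = to_fract ps_y; t = to_fract ps_t; u = ser_u; v = ser_v in
       lpk_des_poly n y t
       = 1 / (1 + u * v) ^ n *
           (\<Sum>k=0..n. of_nat (n choose k) * (1 + u) ^ k * (1 - v) ^ (n - k) * eulerian_poly k v))"
proof -
  define y t s where "y = to_fract ps_y" and "t = to_fract ps_t" and "s = to_fract ps_sqrt"
  note yts = y_def t_def s_def
  have two: "(2 :: series fract) = to_fract 2"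
    unfolding one_add_one[symmetric] by (simp only: to_fract_add to_fract_1)
  have "(4 :: series fract) = 2 + 2" "(4 :: series) = 2 + 2" by simp_all
  then have four: "(4 :: series fract) = to_fract 4" by (simp only: two to_fract_add)
  have "ps_y \<noteq> 1"
    by (simp add: ps_y_def one_pCons flip: fps_const_1_eq_1)
  then have nz: "(2 :: series fract) \<noteq> 0" "y \<noteq> 0" "1 - y \<noteq> 0" "t \<noteq> 0"
    by (simp_all add: yts two four ps_y_def ps_t_def flip: to_fract_1 to_fract_diff)
  have "s ^ 2 = (1 + t) ^ 2 - 4 * y * t"
    using arg_cong[OF ps_sqrt_square, of to_fract]
    by (simp add: yts two four power2_eq_square)
  note uv = uv_identities[OF this nz, of ser_u ser_v]
  have sum: "ser_u + ser_v = t * (1 + ser_u * ser_v)"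
    and prod: "(1 + ser_u) ^ 2 * ser_v = y * t * (1 + ser_u * ser_v) ^ 2"
    by (rule uv; simp add: ser_u_def ser_v_def yts Let_def)+
  have "ser_u + ser_v \<noteq> 0"
    using sum nz ser_nonzero by simp
  \<comment> \<open>The first identity at \<open>u, v\<close>; the two arguments of its right-hand
    side simplify to \<open>y\<close> and \<open>t\<close>.\<close>
  note id = eulerian_lpk_des_identity[OF ser_nonzero(1) this ser_nonzero(2), of n]
  have "(ser_u + ser_v) / (1 + ser_u * ser_v) = t"
    unfolding sum using ser_nonzero by simp
  moreover have "(1 + ser_u) ^ 2 * ser_v / ((ser_u + ser_v) * (1 + ser_u * ser_v)) = y"
    unfolding sum prod using nz ser_nonzero by (simp add: power2_eq_square)
  ultimately have "lpk_des_poly n y t = 1 / (1 + ser_u * ser_v) ^ n *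
      (\<Sum>k=0..n. of_nat (n choose k) * (1 + ser_u) ^ k * (1 - ser_v) ^ (n - k) * eulerian_poly k ser_v)"
    using id ser_nonzero by simp
  then show ?thesis
    using eulerian_lpk_des_identity[OF rf_nonzero, of n] by (simp add: Let_def y_def t_def)
qed

end
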